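(* If $G \in \mathcal{F}$, then $G$ is a $2$-$\gamma_{\rm MB}'$-critical graph.
   Context: All graphs are finite and simple; equality of graphs and membership in a family are meant up to isomorphism. A set $D\subseteq V(G)$ is a dominating set of $G$ if every vertex of $V(G)-D$ has a neighbor in $D$. Maker-Breaker domination game (S-game): two players, Dominator and Staller, alternately select a vertex of $G$ that has not been selected before, with Staller moving first. Dominator's goal is that at some point the set of vertices he has selected is a dominating set of $G$; Staller's goal is to prevent this. The game ends when one of the players accomplishes the goal. If Dominator wins the S-game on $G$ under optimal play, then $\gamma_{\rm MB}'(G)$ is the number of moves Dominator makes when both players play optimally (Dominator wants to minimize the number of his moves, Staller wants to maximize it); equivalently, it is the least $k$ such that Dominator has a strategy guaranteeing that he has selected a dominating set after at most $k$ of his moves. If Staller wins, $\gamma_{\rm MB}'(G)=\infty$. A graph $G$ is $2$-$\gamma_{\rm MB}'$-critical if $\gamma_{\rm MB}'(G)=2$ and $\gamma_{\rm MB}'(G-e)>2$ for every $e\in E(G)$, where $G-e$ is obtained from $G$ by deleting the edge $e$ (and $\infty>2$). The join $G\vee H$ is obtained from the disjoint union of $G$ and $H$ by adding all edges $uv$ with $u\in V(G)$, $v\in V(H)$. For $m\ge 2$ let $H_m=K_2\vee \overline{K_{m-2}}$ (so $H_2=K_2$), a graph on $m$ vertices; $H_0$ is the graph with no vertices. Family $\mathcal{F}$: let $t\ge 1$ be an integer and let $m_1\le m_2$ be integers with $m_1\in\{0,2,3,4,\ldots\}$ and $m_2\ge 2$; if $m_1=0$, assume in addition $t\ge 2$.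 Let $\{v_1,v_2\}$ and $B$ be independent sets of vertices, $v_1\neq v_2$, $|B|=t$. The graph $F_{m_1,t,m_2}$ is obtained from the disjoint union of $H_{m_1}$, $H_{m_2}$, $B$ and $\{v_1,v_2\}$ by adding an edge between $v_1$ and each vertex of $H_{m_1}$, an edge between $v_2$ and each vertex of $H_{m_2}$, and all edges between $\{v_1,v_2\}$ and $B$. The family $\mathcal{F}$ consists of all graphs $F_{m_1,t,m_2}$ with such $m_1,t,m_2$. *)

theory Defs
  imports Main "HOL-Library.Extended_Nat"
begin

record 'a graph =
  verts :: "'a set"
  edges :: "'a set set"

definition finite_simple_graph :: "'a graph \<Rightarrow> bool" where
  "finite_simple_graph G \<longleftrightarrow>
     finite (verts G) \<and> (\<forall>e\<in>edges G. \<exists>u\<in>verts G. \<exists>v\<in>verts G. u \<noteq> v \<and> e = {u, v})"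

definition graph_iso :: "'a graph \<Rightarrow> 'b graph \<Rightarrow> bool" where
  "graph_iso G H \<longleftrightarrow>
     (\<exists>f. bij_betw f (verts G) (verts H) \<and>
          (\<forall>u\<in>verts G. \<forall>v\<in>verts G. {u, v} \<in> edges G \<longleftrightarrow> {f u, f v} \<in> edges H))"

definition delete_edge :: "'a graph \<Rightarrow> 'a set \<Rightarrow> 'a graph" where
  "delete_edge G e = \<lparr>verts = verts G, edges = edges G - {e}\<rparr>"

definition dominating_set :: "'a graph \<Rightarrow> 'a set \<Rightarrow> bool" where
  "dominating_set G D \<longleftrightarrow>
     D \<subseteq> verts G \<and> (\<forall>v\<in>verts G - D. \<exists>u\<in>D. {u, v} \<in> edges G)"


subsection \<open>The Maker-Breaker domination game with Staller moving first\<close>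

text \<open>
  In a position of the game, \<open>D\<close> and \<open>S\<close> are the sets of vertices selected so far by Dominator
  and Staller, and Staller is to move.
\<close>

definition free_verts :: "'a graph \<Rightarrow> 'a set \<Rightarrow> 'a set \<Rightarrow> 'a set" where
  "free_verts G D S = verts G - D - S"

text \<open>
  From the position \<open>(D, S)\<close>, Dominator has a strategy guaranteeing that his set is
  dominating after at most \<open>k\<close> further moves of his. The condition that some vertex is free
  excludes the positions in which the game is over and Dominator has not reached his goal;
  without it the universal quantifier over the moves of Staller would be vacuously true there.
\<close>

primrec dominator_wins_within :: "'a graph \<Rightarrow> nat \<Rightarrow> 'a set \<Rightarrow> 'a set \<Rightarrow> bool" where
  "dominator_wins_within G 0 D S \<longleftrightarrow> dominating_set G D"
| "dominator_wins_within G (Suc k) D S \<longleftrightarrow>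
     dominating_set G D \<or>
     (free_verts G D S \<noteq> {} \<and>
      (\<forall>s\<in>free_verts G D S. \<exists>d\<in>free_verts G D S - {s}.
         dominator_wins_within G k (insert d D) (insert s S)))"

text \<open>The infimum of the empty set is \<open>\<infinity>\<close>: this is the case in which Staller wins.\<close>

definition game_value :: "'a graph \<Rightarrow> 'a set \<Rightarrow> 'a set \<Rightarrow> enat" where
  "game_value G D S = Inf {enat k | k. dominator_wins_within G k D S}"

definition gamma_MB' :: "'a graph \<Rightarrow> enat" where
  "gamma_MB' G = game_value G {} {}"

definition gamma_MB'_critical :: "nat \<Rightarrow> 'a graph \<Rightarrow> bool" where
  "gamma_MB'_critical k G \<longleftrightarrow>
     gamma_MB' G = enat k \<and> (\<forall>e\<in>edges G. gamma_MB' (delete_edge G e) > enat k)"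

lemma dominator_wins_within_mono:
  assumes "dominator_wins_within G k D S" "k \<le> n"
  shows "dominator_wins_within G n D S"
  using assms
proof (induction k arbitrary: n D S)
  case 0
  then show ?case by (cases n) auto
next
  case (Suc k)
  then obtain m where "n = Suc m" "k \<le> m" by (cases n) auto
  with Suc show ?case by simp metis
qed

lemma game_value_le_iff:
  "game_value G D S \<le> enat k \<longleftrightarrow> dominator_wins_within G k D S"
proof
  assume "dominator_wins_within G k D S"
  then show "game_value G D S \<le> enat k"
    unfolding game_value_def by (intro Inf_lower) auto
next
  let ?A = "{enat k | k. dominator_wins_within G k D S}"
  assume le: "game_value G D S \<le> enat k"
  then have "?A \<noteq> {}"
    unfolding game_value_def by (metis Inf_empty enat.distinct(2) infinity_ileE top_enat_def)
  then have "Inf ?A \<in> ?A" by (metis (lifting) LeastI_ex Inf_enat_def ex_in_conv)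
  with le show "dominator_wins_within G k D S"
    unfolding game_value_def by (auto intro: dominator_wins_within_mono)
qed

text \<open>
  The following two lemmas confirm that \<^const>\<open>game_value\<close> is the number of moves made by
  Dominator when he minimizes and Staller maximizes this number.
\<close>

lemma game_value_terminal:
  "dominating_set G D \<Longrightarrow> game_value G D S = 0"
  "\<not> dominating_set G D \<Longrightarrow> free_verts G D S = {} \<Longrightarrow> game_value G D S = \<infinity>"
proof -
  assume "dominating_set G D"
  then show "game_value G D S = 0"
    using game_value_le_iff[of G D S 0] by (simp add: zero_enat_def[symmetric])
next
  assume a: "\<not> dominating_set G D" "free_verts G D S = {}"
  have "\<not> dominator_wins_within G k D S" for k
    using a by (cases k) auto
  then show "game_value G D S = \<infinity>"
    unfolding game_value_def by (simp add: top_enat_def)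
qed

lemma game_value_minimax:
  assumes "\<not> dominating_set G D" "free_verts G D S \<noteq> {}"
  shows "game_value G D S =
    (SUP s\<in>free_verts G D S. INF d\<in>free_verts G D S - {s}.
       eSuc (game_value G (insert d D) (insert s S)))"
    (is "_ = ?R")
proof -
  have INF_le: "(INF x\<in>A. f x) \<le> enat k \<longleftrightarrow> (\<exists>x\<in>A. f x \<le> enat k)"
    for f :: "'b \<Rightarrow> enat" and A k
  proof
    assume le: "(INF x\<in>A. f x) \<le> enat k"
    then have "A \<noteq> {}"
      by (auto simp: top_enat_def)
    then have "Inf (f ` A) \<in> f ` A"
      by (metis (lifting) LeastI_ex Inf_enat_def ex_in_conv image_is_empty)
    with le show "\<exists>x\<in>A. f x \<le> enat k" by auto
  qed (auto intro: INF_lower2)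
  have "game_value G D S \<le> enat k \<longleftrightarrow> ?R \<le> enat k" for k
  proof (cases k)
    case 0
    have "\<not> ?R \<le> enat 0"
      using assms(2) by (auto simp only: SUP_le_iff INF_le) (auto simp: enat_0)
    with 0 show ?thesis
      using assms(1) by (simp add: game_value_le_iff)
  next
    case (Suc n)
    have "eSuc x \<le> enat (Suc n) \<longleftrightarrow> x \<le> enat n" for x
      by (metis eSuc_enat eSuc_ile_mono)
    with Suc show ?thesis
      using assms by (simp add: game_value_le_iff SUP_le_iff INF_le)
  qed
  moreover have "x = y" if "\<And>k. x \<le> enat k \<longleftrightarrow> y \<le> enat k" for x y
    using that by (cases x; cases y) (auto intro: order_antisym)
  ultimately show ?thesis
    by blast
qed


subsection \<open>The graphs \<open>H\<^sub>m\<close> and \<open>F\<^sub>m\<^sub>1\<^sub>,\<^sub>t\<^sub>,\<^sub>m\<^sub>2\<close>\<close>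

definition complete_graph :: "nat \<Rightarrow> nat graph" where
  "complete_graph n =
     \<lparr>verts = {..<n}, edges = {{i, j} | i j. i < n \<and> j < n \<and> i \<noteq> j}\<rparr>"

definition edgeless_graph :: "nat \<Rightarrow> nat graph" where
  "edgeless_graph n = \<lparr>verts = {..<n}, edges = {}\<rparr>"

definition graph_join :: "'a graph \<Rightarrow> 'b graph \<Rightarrow> ('a + 'b) graph" where
  "graph_join G H =
     \<lparr>verts = Inl ` verts G \<union> Inr ` verts H,
      edges = (`) Inl ` edges G \<union> (`) Inr ` edges H \<union>
              {{Inl u, Inr v} | u v. u \<in> verts G \<and> v \<in> verts H}\<rparr>"

text \<open>Only \<open>m = 0\<close> and \<open>m \<ge> 2\<close> are meaningful; the value at \<open>m = 1\<close> is never used.\<close>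

definition H_graph :: "nat \<Rightarrow> (nat + nat) graph" where
  "H_graph m =
     (if m = 0 then \<lparr>verts = {}, edges = {}\<rparr>
      else graph_join (complete_graph 2) (edgeless_graph (m - 2)))"

datatype F_vertex = V1 | V2 | B nat | H1 "nat + nat" | H2 "nat + nat"

definition F_graph :: "nat \<Rightarrow> nat \<Rightarrow> nat \<Rightarrow> F_vertex graph" where
  "F_graph m1 t m2 =
     \<lparr>verts = {V1, V2} \<union> B ` {..<t} \<union> H1 ` verts (H_graph m1) \<union> H2 ` verts (H_graph m2),
      edges = (`) H1 ` edges (H_graph m1) \<union> (`) H2 ` edges (H_graph m2) \<union>
              {{V1, H1 x} | x. x \<in> verts (H_graph m1)} \<union>
              {{V2, H2 x} | x. x \<in> verts (H_graph m2)} \<union>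
              {{v, B i} | v i. v \<in> {V1, V2} \<and> i < t}\<rparr>"

definition family_F :: "'a graph set" where
  "family_F =
     {G. \<exists>m1 t m2. t \<ge> 1 \<and> m1 \<le> m2 \<and> (m1 = 0 \<or> m1 \<ge> 2) \<and> m2 \<ge> 2 \<and>
           (m1 = 0 \<longrightarrow> t \<ge> 2) \<and> graph_iso G (F_graph m1 t m2)}"

lemma finite_simple_H_graph: "finite_simple_graph (H_graph m)"
  unfolding finite_simple_graph_def H_graph_def graph_join_def complete_graph_def
    edgeless_graph_def
  by (auto 0 3 simp: image_iff)

lemma finite_simple_F_graph: "finite_simple_graph (F_graph m1 t m2)"
proof -
  have "finite (verts (F_graph m1 t m2))"
    using finite_simple_H_graph[of m1] finite_simple_H_graph[of m2]
    by (simp add: F_graph_def finite_simple_graph_def)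
  moreover have "\<exists>u\<in>verts (F_graph m1 t m2). \<exists>v\<in>verts (F_graph m1 t m2). u \<noteq> v \<and> e = {u, v}"
    if e: "e \<in> edges (F_graph m1 t m2)" for e
  proof -
    consider (h1) e' where "e' \<in> edges (H_graph m1)" "e = H1 ` e'"
      | (h2) e' where "e' \<in> edges (H_graph m2)" "e = H2 ` e'"
      | (v1) x where "x \<in> verts (H_graph m1)" "e = {V1, H1 x}"
      | (v2) x where "x \<in> verts (H_graph m2)" "e = {V2, H2 x}"
      | (b) v i where "v \<in> {V1, V2}" "i < t" "e = {v, B i}"
      using e unfolding F_graph_def graph.select_convs by blast
    then show ?thesis
    proof cases
      case h1
      then obtain u v where "u \<in> verts (H_graph m1)" "v \<in> verts (H_graph m1)" "u \<noteq> v" "e' = {u, v}"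
        using finite_simple_H_graph[of m1] unfolding finite_simple_graph_def by blast
      with h1 show ?thesis
        by (intro bexI[of _ "H1 u"] bexI[of _ "H1 v"]) (auto simp: F_graph_def)
    next
      case h2
      then obtain u v where "u \<in> verts (H_graph m2)" "v \<in> verts (H_graph m2)" "u \<noteq> v" "e' = {u, v}"
        using finite_simple_H_graph[of m2] unfolding finite_simple_graph_def by blast
      with h2 show ?thesis
        by (intro bexI[of _ "H2 u"] bexI[of _ "H2 v"]) (auto simp: F_graph_def)
    next
      case v1
      then show ?thesis
        by (intro bexI[of _ V1] bexI[of _ "H1 x"]) (auto simp: F_graph_def)
    next
      case v2
      then show ?thesis
        by (intro bexI[of _ V2] bexI[of _ "H2 x"]) (auto simp: F_graph_def)
    next
      case b
      then show ?thesis
        by (intro bexI[of _ v] bexI[of _ "B i"]) (auto simp: F_graph_def)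
    qed
  qed
  ultimately show ?thesis
    by (simp add: finite_simple_graph_def)
qed

end

theory Submission
  imports Defs
begin

text \<open>
  In a graph without a dominating vertex, Dominator wins within two moves iff for every first move
  \<open>s\<close> of Staller some vertex lies in two dominating pairs that avoid \<open>s\<close>. The dominating pairs of \<open>F\<close> form a double star with centres \<open>V1\<close> and \<open>V2\<close>: a
  pair avoiding \<open>V2\<close> consists of \<open>V1\<close> and a universal vertex of \<open>H2\<close>, and vice versa (with \<open>B\<close> in
  place of \<open>H1\<close> if \<open>m1 = 0\<close>). Both stars have at least two leaves, so Dominator wins in two moves.
  Deleting an edge leaves at most one dominating pair avoiding a suitable centre, namely \<open>V2\<close> for
  edges at \<open>V1\<close> or inside \<open>H2\<close>, and \<open>V1\<close> for the others; Staller starts with that centre and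
  then breaks the remaining pair.
\<close>

section \<open>Adjacency and universal vertices in \<open>H_graph m\<close>\<close>

lemma doubleton_image_iff:
  assumes "inj f"
  shows "{f x, f y} \<in> (`) f ` A \<longleftrightarrow> {x, y} \<in> A"
proof
  assume "{f x, f y} \<in> (`) f ` A"
  then obtain e where "e \<in> A" "f ` {x, y} = f ` e"
    by auto
  with assms show "{x, y} \<in> A"
    by (metis inj_image_eq_iff)
next
  assume "{x, y} \<in> A"
  then show "{f x, f y} \<in> (`) f ` A"
    by (intro rev_image_eqI[of "{x, y}"]) auto
qed

lemma verts_H_graph:
  "m \<ge> 2 \<Longrightarrow> verts (H_graph m) = Inl ` {..<2} \<union> Inr ` {..<m - 2}"
  "verts (H_graph 0) = {}"
  by (simp_all add: H_graph_def graph_join_def complete_graph_def edgeless_graph_def)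

lemma edges_H_graph_0: "edges (H_graph 0) = {}"
  by (simp add: H_graph_def)

lemma edges_H_graph_iff:
  assumes "m \<ge> 2"
  shows "{Inl i, Inl j} \<in> edges (H_graph m) \<longleftrightarrow> i < 2 \<and> j < 2 \<and> i \<noteq> j"
    and "{Inl i, Inr k} \<in> edges (H_graph m) \<longleftrightarrow> i < 2 \<and> k < m - 2"
    and "{Inr k, Inl i} \<in> edges (H_graph m) \<longleftrightarrow> i < 2 \<and> k < m - 2"
    and "{Inr k, Inr l} \<notin> edges (H_graph m)"
proof -
  have *: "edges (H_graph m) =
      (`) Inl ` {{i, j} | i j. i < 2 \<and> j < 2 \<and> i \<noteq> j} \<union> {{Inl i, Inr k} | i k. i < 2 \<and> k < m - 2}"
    using assms by (simp add: H_graph_def graph_join_def complete_graph_def edgeless_graph_def)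
  show "{Inl i, Inl j} \<in> edges (H_graph m) \<longleftrightarrow> i < 2 \<and> j < 2 \<and> i \<noteq> j"
    unfolding * Un_iff doubleton_image_iff[OF inj_Inl]
    by (auto simp: doubleton_eq_iff)
  show 2: "{Inl i, Inr k} \<in> edges (H_graph m) \<longleftrightarrow> i < 2 \<and> k < m - 2"
    unfolding * by (auto simp: doubleton_eq_iff)
  then show "{Inr k, Inl i} \<in> edges (H_graph m) \<longleftrightarrow> i < 2 \<and> k < m - 2"
    by (simp add: insert_commute)
  show "{Inr k, Inr l} \<notin> edges (H_graph m)"
    unfolding * by (auto simp: doubleton_eq_iff)
qed

text \<open>For \<open>m = 3\<close> the graph is a triangle, so that \<open>Inr 0\<close> is universal as well.\<close>

lemma H_graph_universal_vertex:
  assumes "m \<ge> 2" "p \<in> verts (H_graph m)"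
    and "\<forall>q\<in>verts (H_graph m) - {p}. {p, q} \<in> edges (H_graph m)"
  shows "p = Inl 0 \<or> p = Inl 1 \<or> m = 3 \<and> p = Inr 0"
proof (cases p)
  case (Inl i)
  with assms show ?thesis by (auto simp: verts_H_graph)
next
  case (Inr k)
  have "l = k" if "l < m - 2" for l
  proof (rule ccontr)
    assume "l \<noteq> k"
    with that assms(1) Inr have "Inr l \<in> verts (H_graph m) - {p}"
      by (auto simp: verts_H_graph)
    with assms(3) have "{p, Inr l} \<in> edges (H_graph m)" by blast
    with assms(1) Inr show False by (simp add: edges_H_graph_iff)
  qed
  \<comment> \<open>All indices below \<open>m - 2\<close> equal \<open>k\<close>. Index 0 is one of
    them, so \<open>k = 0\<close>; index 1 must not be, so \<open>m - 2 = 1\<close>.\<close>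
  from this[of 0] this[of 1] have "k = 0 \<and> m = 3" if "k < m - 2"
    using that by linarith
  moreover have "k < m - 2"
    using assms(1,2) Inr by (auto simp: verts_H_graph)
  ultimately have "k = 0 \<and> m = 3" by simp
  with Inr show ?thesis by simp
qed

text \<open>The ends of the deleted edge stop being universal. Every edge meets
  \<open>{Inl 0, Inl 1}\<close>, which leaves at most one candidate; for \<open>m = 3\<close> the
  edge removes two of three.\<close>

lemma H_graph_delete_edge_universal_vertex:
  assumes m: "m \<ge> 2" and e: "e \<in> edges (H_graph m)"
  shows "\<exists>z\<in>verts (H_graph m). \<forall>p\<in>verts (H_graph m).
    (\<forall>q\<in>verts (H_graph m) - {p}. {p, q} \<in> edges (H_graph m) - {e}) \<longrightarrow> p = z"
proof -
  define U where "U = {p \<in> verts (H_graph m).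
    \<forall>q\<in>verts (H_graph m) - {p}. {p, q} \<in> edges (H_graph m) - {e}}"
  obtain u v where uv: "u \<in> verts (H_graph m)" "v \<in> verts (H_graph m)" "u \<noteq> v" "e = {u, v}"
    using e finite_simple_H_graph[of m] unfolding finite_simple_graph_def by blast
  have "u \<notin> U" "v \<notin> U"
    using uv by (auto simp: U_def insert_commute)
  moreover have "U \<subseteq> {Inl 0, Inl 1} \<union> (if m = 3 then {Inr 0} else {})"
    using H_graph_universal_vertex[OF m] by (auto simp: U_def)
  moreover have "u \<in> {Inl 0, Inl 1} \<or> v \<in> {Inl 0, Inl 1}"
    using e uv m by (cases u; cases v) (auto simp: edges_H_graph_iff less_2_cases_iff)
  moreover have "u \<in> {Inl 0, Inl 1, Inr 0}" "v \<in> {Inl 0, Inl 1, Inr 0}" if "m = 3"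
    using uv that by (auto simp: verts_H_graph less_2_cases_iff)
  ultimately have "\<exists>z\<in>{Inl 0, Inl 1, Inr 0}. U \<subseteq> {z}"
    using uv(3) by (cases "m = 3") (simp_all, blast+)
  then obtain z where "U \<subseteq> {z}" by blast
  \<comment> \<open>For \<open>m = 2\<close> the vertex \<open>z\<close> may be
    \<open>Inr 0\<close>, outside the graph. Then \<open>U\<close> is empty and any vertex, here
    \<open>u\<close>, serves instead.\<close>
  then have "U \<subseteq> {if z \<in> verts (H_graph m) then z else u}"
    by (auto simp: U_def)
  with uv(1) show ?thesis
    unfolding U_def by (intro bexI[of _ "if z \<in> verts (H_graph m) then z else u"]) auto
qed

section \<open>Adjacency in \<open>F_graph\<close>\<close>

lemma verts_F_graph:
  "V1 \<in> verts (F_graph m1 t m2)" "V2 \<in> verts (F_graph m1 t m2)"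
  "B i \<in> verts (F_graph m1 t m2) \<longleftrightarrow> i < t"
  "H1 p \<in> verts (F_graph m1 t m2) \<longleftrightarrow> p \<in> verts (H_graph m1)"
  "H2 p \<in> verts (F_graph m1 t m2) \<longleftrightarrow> p \<in> verts (H_graph m2)"
  by (auto simp: F_graph_def)

text \<open>Case distinctions on two vertices yield pairs \<open>{x, x}\<close>, which the
  simplifier collapses to \<open>{x}\<close>.\<close>

lemma edges_F_graph_iff_loop:
  "{x} \<notin> edges (F_graph m1 t m2)"
proof
  assume "{x} \<in> edges (F_graph m1 t m2)"
  then show False
    using finite_simple_F_graph[of m1 t m2] unfolding finite_simple_graph_def
    by (metis doubleton_eq_iff insert_absorb2)
qed

lemma edges_F_graph_iff_aux:
  "{V1, V2} \<notin> edges (F_graph m1 t m2)"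
  "{V1, B i} \<in> edges (F_graph m1 t m2) \<longleftrightarrow> i < t"
  "{V2, B i} \<in> edges (F_graph m1 t m2) \<longleftrightarrow> i < t"
  "{V1, H1 p} \<in> edges (F_graph m1 t m2) \<longleftrightarrow> p \<in> verts (H_graph m1)"
  "{V2, H1 p} \<notin> edges (F_graph m1 t m2)"
  "{V1, H2 p} \<notin> edges (F_graph m1 t m2)"
  "{V2, H2 p} \<in> edges (F_graph m1 t m2) \<longleftrightarrow> p \<in> verts (H_graph m2)"
  "{B i, B j} \<notin> edges (F_graph m1 t m2)"
  "{B i, H1 p} \<notin> edges (F_graph m1 t m2)"
  "{B i, H2 p} \<notin> edges (F_graph m1 t m2)"
  "{H1 p, H2 q} \<notin> edges (F_graph m1 t m2)"
  "{H1 p, H1 q} \<in> edges (F_graph m1 t m2) \<longleftrightarrow> {p, q} \<in> edges (H_graph m1)"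
  "{H2 p, H2 q} \<in> edges (F_graph m1 t m2) \<longleftrightarrow> {p, q} \<in> edges (H_graph m2)"
proof -
  have inj: "inj H1" "inj H2"
    by (auto intro: injI)
  \<comment> \<open>Rules out that a pair with an end outside a copy of \<open>H_graph\<close> is an
    edge inside that copy.\<close>
  have range: "{x, y} \<in> (`) f ` A \<Longrightarrow> x \<in> range f \<and> y \<in> range f"
    for f :: "nat + nat \<Rightarrow> F_vertex" and x y A
    by blast
  show "{V1, V2} \<notin> edges (F_graph m1 t m2)"
    by (auto simp: F_graph_def doubleton_eq_iff dest!: range)
  show "{V1, B i} \<in> edges (F_graph m1 t m2) \<longleftrightarrow> i < t"
    by (auto simp: F_graph_def doubleton_eq_iff dest!: range)
  show "{V2, B i} \<in> edges (F_graph m1 t m2) \<longleftrightarrow> i < t"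
    by (auto simp: F_graph_def doubleton_eq_iff dest!: range)
  show "{V1, H1 p} \<in> edges (F_graph m1 t m2) \<longleftrightarrow> p \<in> verts (H_graph m1)"
    by (auto simp: F_graph_def doubleton_eq_iff dest!: range)
  show "{V2, H1 p} \<notin> edges (F_graph m1 t m2)"
    by (auto simp: F_graph_def doubleton_eq_iff dest!: range)
  show "{V1, H2 p} \<notin> edges (F_graph m1 t m2)"
    by (auto simp: F_graph_def doubleton_eq_iff dest!: range)
  show "{V2, H2 p} \<in> edges (F_graph m1 t m2) \<longleftrightarrow> p \<in> verts (H_graph m2)"
    by (auto simp: F_graph_def doubleton_eq_iff dest!: range)
  show "{B i, B j} \<notin> edges (F_graph m1 t m2)"
    by (auto simp: F_graph_def doubleton_eq_iff dest!: range)
  show "{B i, H1 p} \<notin> edges (F_graph m1 t m2)"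
    by (auto simp: F_graph_def doubleton_eq_iff dest!: range)
  show "{B i, H2 p} \<notin> edges (F_graph m1 t m2)"
    by (auto simp: F_graph_def doubleton_eq_iff dest!: range)
  show "{H1 p, H2 q} \<notin> edges (F_graph m1 t m2)"
    by (auto simp: F_graph_def doubleton_eq_iff dest!: range)
  show "{H1 p, H1 q} \<in> edges (F_graph m1 t m2) \<longleftrightarrow> {p, q} \<in> edges (H_graph m1)"
    "{H2 p, H2 q} \<in> edges (F_graph m1 t m2) \<longleftrightarrow> {p, q} \<in> edges (H_graph m2)"
    unfolding F_graph_def graph.select_convs Un_iff doubleton_image_iff[OF inj(1)]
      doubleton_image_iff[OF inj(2)]
    by (auto simp: doubleton_eq_iff)
qed

lemma edges_F_graph_iff_sym:
  "{V2, V1} \<notin> edges (F_graph m1 t m2)"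
  "{B i, V1} \<in> edges (F_graph m1 t m2) \<longleftrightarrow> i < t"
  "{B i, V2} \<in> edges (F_graph m1 t m2) \<longleftrightarrow> i < t"
  "{H1 p, V1} \<in> edges (F_graph m1 t m2) \<longleftrightarrow> p \<in> verts (H_graph m1)"
  "{H1 p, V2} \<notin> edges (F_graph m1 t m2)"
  "{H2 p, V1} \<notin> edges (F_graph m1 t m2)"
  "{H2 p, V2} \<in> edges (F_graph m1 t m2) \<longleftrightarrow> p \<in> verts (H_graph m2)"
  "{H1 p, B i} \<notin> edges (F_graph m1 t m2)"
  "{H2 p, B i} \<notin> edges (F_graph m1 t m2)"
  "{H2 q, H1 p} \<notin> edges (F_graph m1 t m2)"
  by (subst insert_commute, simp add: edges_F_graph_iff_aux)+

lemmas edges_F_graph_iff =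
  edges_F_graph_iff_loop edges_F_graph_iff_aux edges_F_graph_iff_sym

section \<open>Games of at most two moves in terms of dominating pairs\<close>

lemma dominating_setD:
  "dominating_set G D \<Longrightarrow> v \<in> verts G \<Longrightarrow> v \<in> D \<or> (\<exists>u\<in>D. {u, v} \<in> edges G)"
  by (auto simp: dominating_set_def)

lemma verts_delete_edge [simp]: "verts (delete_edge G e) = verts G"
  and edges_delete_edge [simp]: "edges (delete_edge G e) = edges G - {e}"
  by (simp_all add: delete_edge_def)

lemma dominating_set_delete_edgeD: "dominating_set (delete_edge G e) D \<Longrightarrow> dominating_set G D"
  by (auto simp: dominating_set_def)

lemma not_wins_within_1:
  assumes "s \<in> verts G" and "\<And>x. x \<in> verts G - {s} \<Longrightarrow> \<not> dominating_set G {x}"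
  shows "\<not> dominator_wins_within G 1 {} {}"
  using assms by (auto simp: free_verts_def dominating_set_def[of G "{}"])

text \<open>Staller opens with \<open>s\<close> and next takes a vertex of the only pair that may
  dominate. The pair \<open>{w, z}\<close> itself need not dominate, so the case of no dominating
  pair is covered too.\<close>

lemma not_wins_within_2:
  assumes s: "s \<in> verts G" "w \<in> verts G - {s}" "z \<in> verts G - {s}" "w \<noteq> z"
    and pair: "\<And>x y. {x, y} \<subseteq> verts G - {s} \<Longrightarrow> dominating_set G {x, y} \<Longrightarrow> {x, y} = {w, z}"
  shows "\<not> dominator_wins_within G 2 {} {}"
proof
  assume "dominator_wins_within G 2 {} {}"
  moreover have "\<not> dominating_set G {}"
    using s(1) by (auto simp: dominating_set_def)
  ultimately have "\<exists>d\<in>verts G - {s}. dominator_wins_within G 1 {d} {s}"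
    using s(1) by (simp add: numeral_2_eq_2 free_verts_def)
  then obtain d where d: "d \<in> verts G - {s}" and "dominator_wins_within G 1 {d} {s}"
    by blast
  \<comment> \<open>A dominating singleton would be the pair \<open>{d, d}\<close>, but
    \<open>w\<close> and \<open>z\<close> differ.\<close>
  moreover have "\<not> dominating_set G {d}"
    using pair[of d d] d s(4) by auto
  ultimately have "\<forall>s'\<in>verts G - {d, s}. \<exists>d'\<in>verts G - {d, s, s'}. dominating_set G {d', d}"
    by (fastforce simp: free_verts_def)
  moreover define s' where "s' = (if d = w then z else w)"
  then have "s' \<in> verts G - {d, s}" using s by auto
  ultimately obtain d' where "d' \<in> verts G - {d, s, s'}" "dominating_set G {d', d}"
    by blast
  with pair[of d' d] d have "{d', d} = {w, z}" by auto
  with \<open>d' \<in> verts G - {d, s, s'}\<close> show False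
    by (auto simp: s'_def doubleton_eq_iff split: if_splits)
qed

text \<open>A double threat: after Dominator takes \<open>d\<close>, Staller cannot take both
  \<open>a\<close> and \<open>b\<close>.\<close>

lemma wins_within_2I:
  assumes "verts G \<noteq> {}"
    and "\<And>s. s \<in> verts G \<Longrightarrow> \<exists>d a b. {d, a, b} \<subseteq> verts G - {s} \<and> distinct [d, a, b] \<and>
      dominating_set G {d, a} \<and> dominating_set G {d, b}"
  shows "dominator_wins_within G 2 {} {}"
proof -
  have "\<exists>d\<in>verts G - {s}. dominator_wins_within G 1 {d} {s}" if s: "s \<in> verts G" for s
  proof -
    obtain d a b where *: "{d, a, b} \<subseteq> verts G - {s}" "distinct [d, a, b]"
      "dominating_set G {d, a}" "dominating_set G {d, b}"
      using assms(2)[OF s] by blast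
    then have "dominating_set G {a, d}" "dominating_set G {b, d}"
      by (simp_all add: insert_commute)
    with * have "\<exists>d'\<in>free_verts G {d} {s} - {s'}. dominating_set G {d', d}" for s'
      by (cases "s' = a") (auto simp: free_verts_def)
    \<comment> \<open>Discharges the condition in the game that some vertex is still free.\<close>
    moreover have "a \<in> free_verts G {d} {s}"
      using * by (auto simp: free_verts_def)
    ultimately have "dominator_wins_within G 1 {d} {s}"
      by auto
    with * show ?thesis by blast
  qed
  with assms(1) have "dominator_wins_within G (Suc 1) {} {}"
    unfolding dominator_wins_within.simps(2)[of G 1] free_verts_def Diff_empty by blast
  then show ?thesis
    by (simp only: Suc_1)
qed

section \<open>Invariance under isomorphism\<close>

text \<open>The map is explicit because positions and deleted edges are transported along
  it.\<close>

definition graph_iso_on :: "('a \<Rightarrow> 'b) \<Rightarrow> 'a graph \<Rightarrow> 'b graph \<Rightarrow> bool" where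
  "graph_iso_on f G H \<longleftrightarrow> bij_betw f (verts G) (verts H) \<and>
     (\<forall>u\<in>verts G. \<forall>v\<in>verts G. {u, v} \<in> edges G \<longleftrightarrow> {f u, f v} \<in> edges H)"

lemma dominating_set_iso:
  assumes iso: "graph_iso_on f G H" and D: "D \<subseteq> verts G"
  shows "dominating_set H (f ` D) \<longleftrightarrow> dominating_set G D"
proof -
  have inj: "inj_on f (verts G)" and H: "verts H = f ` verts G"
    using iso by (auto simp: graph_iso_on_def bij_betw_def)
  have "verts H - f ` D = f ` (verts G - D)"
    using inj H D by (auto simp: inj_on_def)
  moreover have "(\<exists>u\<in>f ` D. {u, f v} \<in> edges H) \<longleftrightarrow> (\<exists>u\<in>D. {u, v} \<in> edges G)"
    if "v \<in> verts G" for v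
    using iso D that by (auto simp: graph_iso_on_def)
  ultimately show ?thesis
    using D H by (auto simp: dominating_set_def)
qed

lemma dominator_wins_within_iso:
  assumes iso: "graph_iso_on f G H" and "D \<subseteq> verts G" "S \<subseteq> verts G"
  shows "dominator_wins_within H k (f ` D) (f ` S) \<longleftrightarrow> dominator_wins_within G k D S"
  using assms(2,3)
proof (induction k arbitrary: D S)
  case 0
  then show ?case by (simp add: dominating_set_iso[OF iso])
next
  case (Suc k)
  have inj: "inj_on f (verts G)" and H: "verts H = f ` verts G"
    using iso by (auto simp: graph_iso_on_def bij_betw_def)
  have free: "free_verts H (f ` D) (f ` S) = f ` free_verts G D S"
    using inj H Suc.prems unfolding free_verts_def inj_on_def by blast
  have "f ` free_verts G D S - {f s} = f ` (free_verts G D S - {s})"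
    if "s \<in> free_verts G D S" for s
    using inj that unfolding free_verts_def inj_on_def by blast
  moreover have "dominator_wins_within H k (insert (f d) (f ` D)) (insert (f s) (f ` S)) \<longleftrightarrow>
      dominator_wins_within G k (insert d D) (insert s S)"
    if "d \<in> free_verts G D S" "s \<in> free_verts G D S" for d s
    using Suc.IH[of "insert d D" "insert s S"] that Suc.prems by (simp add: free_verts_def)
  ultimately show ?case
    using Suc.prems by (auto simp: free dominating_set_iso[OF iso])
qed

lemma gamma_MB'_iso: "graph_iso_on f G H \<Longrightarrow> gamma_MB' H = gamma_MB' G"
  using dominator_wins_within_iso[of f G H "{}" "{}"]
  by (simp add: gamma_MB'_def game_value_def)

lemma graph_iso_on_delete_edge:
  assumes "graph_iso_on f G H" and e: "e \<subseteq> verts G"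
  shows "graph_iso_on f (delete_edge G e) (delete_edge H (f ` e))"
proof -
  have "{f u, f v} = f ` e \<longleftrightarrow> {u, v} = e" if "u \<in> verts G" "v \<in> verts G" for u v
    using assms that inj_on_image_eq_iff[of f "verts G" "{u, v}" e]
    by (simp add: graph_iso_on_def bij_betw_def)
  with assms(1) show ?thesis
    by (auto simp: graph_iso_on_def)
qed

lemma gamma_MB'_critical_iso:
  assumes iso: "graph_iso_on f G H" and G: "finite_simple_graph G"
    and crit: "gamma_MB'_critical k H"
  shows "gamma_MB'_critical k G"
proof -
  have "gamma_MB' (delete_edge G e) > enat k" if e: "e \<in> edges G" for e
  proof -
    obtain u v where uv: "u \<in> verts G" "v \<in> verts G" "e = {u, v}"
      using G e by (auto simp: finite_simple_graph_def)
    then have "f ` e \<in> edges H"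
      using iso e by (auto simp: graph_iso_on_def)
    with crit show ?thesis
      using gamma_MB'_iso[OF graph_iso_on_delete_edge[OF iso, of e]] uv
      by (auto simp: gamma_MB'_critical_def)
  qed
  with crit gamma_MB'_iso[OF iso] show ?thesis
    by (simp add: gamma_MB'_critical_def)
qed

section \<open>The symmetry exchanging the two sides of \<open>F_graph\<close>\<close>

fun swap_sides :: "F_vertex \<Rightarrow> F_vertex" where
  "swap_sides V1 = V2"
| "swap_sides V2 = V1"
| "swap_sides (B i) = B i"
| "swap_sides (H1 p) = H2 p"
| "swap_sides (H2 p) = H1 p"

lemma swap_sides_swap_sides [simp]: "swap_sides (swap_sides x) = x"
  by (cases x) auto

lemma graph_iso_on_swap_sides: "graph_iso_on swap_sides (F_graph m1 t m2) (F_graph m2 t m1)"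
proof -
  have verts: "swap_sides x \<in> verts (F_graph m2 t m1)" if "x \<in> verts (F_graph m1 t m2)" for x m1 m2
    using that by (cases x) (auto simp: verts_F_graph)
  have "bij_betw swap_sides (verts (F_graph m1 t m2)) (verts (F_graph m2 t m1))"
    by (rule bij_betw_byWitness[of _ swap_sides]) (auto intro: verts)
  moreover have "{swap_sides u, swap_sides v} \<in> edges (F_graph m2 t m1) \<longleftrightarrow>
      {u, v} \<in> edges (F_graph m1 t m2)" for u v
    by (cases u; cases v) (simp_all add: edges_F_graph_iff insert_commute)
  ultimately show ?thesis
    by (simp add: graph_iso_on_def)
qed

section \<open>Dominating pairs avoiding a centre, and their loss under edge deletion\<close>

text \<open>Without \<open>V2\<close>, the \<open>H2\<close> part can only be dominated from within,
  so one vertex lies there. It reaches nothing in \<open>B\<close> or the \<open>H1\<close> part,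
  and only \<open>V1\<close> dominates all of these and itself. Taking \<open>x = y\<close> excludes
  dominating singletons.\<close>

lemma F_graph_dominating_pair:
  assumes m: "m2 \<ge> 2" "t \<ge> 1" "m1 = 0 \<or> m1 \<ge> 2" "m1 = 0 \<longrightarrow> t \<ge> 2"
    and xy: "{x, y} \<subseteq> verts (F_graph m1 t m2) - {V2}"
    and dom: "dominating_set (F_graph m1 t m2) {x, y}"
  shows "\<exists>p\<in>verts (H_graph m2). {x, y} = {V1, H2 p} \<and>
    (\<forall>q\<in>verts (H_graph m2) - {p}. {p, q} \<in> edges (H_graph m2))"
proof -
  note dominated = dominating_setD[OF dom]
  have "Inl 0 \<in> verts (H_graph m2)"
    using m(1) by (simp add: verts_H_graph)
  then have "\<exists>p. x = H2 p \<or> y = H2 p"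
    using dominated[of "H2 (Inl 0)"] xy
    by (cases x; cases y) (auto simp: verts_F_graph edges_F_graph_iff)
  then obtain p y' where p: "{x, y} = {H2 p, y'}" by (metis insert_commute)
  have "y' \<noteq> V2" and pH: "p \<in> verts (H_graph m2)"
    using xy unfolding p by (auto simp: verts_F_graph)
  have y': "y' = V1"
  proof (cases y')
    case V2
    with \<open>y' \<noteq> V2\<close> show ?thesis by simp
  next
    case (B i)
    show ?thesis
    \<comment> \<open>A vertex of \<open>B\<close> misses another vertex of \<open>B\<close> if
      \<open>m1 = 0\<close>, and the \<open>H1\<close> part otherwise.\<close>
    proof (cases "m1 = 0")
      case True
      with m have "B 0 \<in> verts (F_graph m1 t m2)" "B 1 \<in> verts (F_graph m1 t m2)"
        by (auto simp: verts_F_graph)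
      from this[THEN dominated] B show ?thesis
        unfolding p by (auto simp: edges_F_graph_iff)
    next
      case False
      with m have "H1 (Inl 0) \<in> verts (F_graph m1 t m2)"
        by (auto simp: verts_F_graph verts_H_graph)
      from dominated[OF this] B show ?thesis
        unfolding p by (auto simp: edges_F_graph_iff)
    qed
  next
    case (H1 q)
    with dominated[of "B 0"] m show ?thesis
      unfolding p by (auto simp: verts_F_graph edges_F_graph_iff)
  next
    case (H2 q)
    with dominated[of V1] show ?thesis
      unfolding p by (auto simp: verts_F_graph edges_F_graph_iff)
  qed
  have "{p, q} \<in> edges (H_graph m2)" if "q \<in> verts (H_graph m2) - {p}" for q
    using dominated[of "H2 q"] that unfolding p y' by (auto simp: verts_F_graph edges_F_graph_iff)
  moreover have "{x, y} = {V1, H2 p}"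
    unfolding p y' by (rule insert_commute)
  ultimately show ?thesis using pH by blast
qed

text \<open>Edges are grouped by the centre they meet, so those at \<open>B\<close> need no case of
  their own.\<close>

lemma edges_F_graph_cases:
  assumes "e \<in> edges (F_graph m1 t m2)"
  obtains (V1) x where "e = {V1, x}" "{V1, x} \<in> edges (F_graph m1 t m2)"
  | (V2) x where "e = {V2, x}" "{V2, x} \<in> edges (F_graph m1 t m2)"
  | (H1) e' where "e = H1 ` e'" "e' \<in> edges (H_graph m1)"
  | (H2) e' where "e = H2 ` e'" "e' \<in> edges (H_graph m2)"
proof -
  have "e \<in> (`) H1 ` edges (H_graph m1) \<or> e \<in> (`) H2 ` edges (H_graph m2) \<or>
      (\<exists>x. e = {V1, x}) \<or> (\<exists>x. e = {V2, x})"
    using assms unfolding F_graph_def graph.select_convs by blast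
  with assms that show ?thesis by blast
qed

lemma F_graph_delete_edge_V1:
  assumes m: "m2 \<ge> 2" "t \<ge> 1" "m1 = 0 \<or> m1 \<ge> 2" "m1 = 0 \<longrightarrow> t \<ge> 2"
    and e: "{V1, x} \<in> edges (F_graph m1 t m2)"
  shows "\<not> dominator_wins_within (delete_edge (F_graph m1 t m2) {V1, x}) 2 {} {}"
\<comment> \<open>No dominating pair avoiding \<open>V2\<close> survives: \<open>x\<close> lies in
  \<open>B\<close> or the \<open>H1\<close> part and has lost \<open>V1\<close>. The pair
  \<open>V1\<close>, \<open>B 0\<close> is a mere placeholder.\<close>
proof (rule not_wins_within_2[of V2 _ V1 "B 0"])
  fix u v
  assume "{u, v} \<subseteq> verts (delete_edge (F_graph m1 t m2) {V1, x}) - {V2}"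
    and dom: "dominating_set (delete_edge (F_graph m1 t m2) {V1, x}) {u, v}"
  with F_graph_dominating_pair[OF m] obtain p where "{u, v} = {V1, H2 p}"
    by (metis dominating_set_delete_edgeD verts_delete_edge)
  with dominating_setD[OF dom, of x] e show "{u, v} = {V1, B 0}"
    by (cases x) (auto simp: verts_F_graph edges_F_graph_iff)
qed (use m in \<open>auto simp: verts_F_graph\<close>)

lemma F_graph_delete_edge_H2:
  assumes m: "m2 \<ge> 2" "t \<ge> 1" "m1 = 0 \<or> m1 \<ge> 2" "m1 = 0 \<longrightarrow> t \<ge> 2"
    and e: "e \<in> edges (H_graph m2)"
  shows "\<not> dominator_wins_within (delete_edge (F_graph m1 t m2) (H2 ` e)) 2 {} {}"
proof -
  let ?G = "delete_edge (F_graph m1 t m2) (H2 ` e)"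
  obtain z where z: "z \<in> verts (H_graph m2)"
    and uniq: "\<And>p. p \<in> verts (H_graph m2) \<Longrightarrow>
      \<forall>q\<in>verts (H_graph m2) - {p}. {p, q} \<in> edges (H_graph m2) - {e} \<Longrightarrow> p = z"
    using H_graph_delete_edge_universal_vertex[OF m(1) e] by blast
  show ?thesis
  \<comment> \<open>The partner of \<open>V1\<close> must be universal in \<open>H_graph m2\<close>
    without \<open>e\<close>, which leaves only \<open>z\<close>.\<close>
  proof (rule not_wins_within_2[of V2 _ V1 "H2 z"])
    fix u v
    assume "{u, v} \<subseteq> verts ?G - {V2}" and dom: "dominating_set ?G {u, v}"
    with F_graph_dominating_pair[OF m] obtain p
      where p: "p \<in> verts (H_graph m2)" "{u, v} = {V1, H2 p}"
      by (metis dominating_set_delete_edgeD verts_delete_edge)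
    have "{p, q} \<in> edges (H_graph m2) - {e}" if "q \<in> verts (H_graph m2) - {p}" for q
      using dominating_setD[OF dom, of "H2 q"] that unfolding p(2)
      by (auto simp: verts_F_graph edges_F_graph_iff)
    with uniq p show "{u, v} = {V1, H2 z}" by blast
  qed (use z in \<open>auto simp: verts_F_graph\<close>)
qed

text \<open>If \<open>m1 = 0\<close>, then \<open>B\<close> plays the role of \<open>H1\<close>: the dominating pairs avoiding \<open>V1\<close> are the
  pairs \<open>{V2, B i}\<close>.\<close>

lemma F_graph_0_dominating_pair:
  assumes m: "m2 \<ge> 2" "t \<ge> 2"
    and xy: "{x, y} \<subseteq> verts (F_graph 0 t m2) - {V1}"
    and dom: "dominating_set (F_graph 0 t m2) {x, y}"
  shows "\<exists>i<t. {x, y} = {V2, B i}"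
proof (cases "V2 \<in> {x, y}")
  case True
  then obtain y' where y': "{x, y} = {V2, y'}" by auto
  with dominating_setD[OF dom, of V1] xy have "\<exists>i<t. y' = B i"
    unfolding y' by (cases y') (auto simp: verts_F_graph edges_F_graph_iff verts_H_graph)
  with y' show ?thesis by blast
next
  case False
  \<comment> \<open>A dominating pair avoiding \<open>V2\<close> contains \<open>V1\<close>,
    contrary to \<open>xy\<close>.\<close>
  with xy m have "V1 \<in> {x, y}"
    using F_graph_dominating_pair[of m2 t 0 x y] dom by auto
  with xy show ?thesis by auto
qed

lemma F_graph_0_delete_edge_V2:
  assumes m: "m2 \<ge> 2" "t \<ge> 2"
    and e: "{V2, x} \<in> edges (F_graph 0 t m2)"
  shows "\<not> dominator_wins_within (delete_edge (F_graph 0 t m2) {V2, x}) 2 {} {}"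
\<comment> \<open>If \<open>x\<close> is in \<open>B\<close>, the pair must contain \<open>x\<close>
  itself to dominate it. If \<open>x\<close> is in the \<open>H2\<close> part, no pair survives and
  \<open>B 0\<close> is a filler.\<close>
proof (rule not_wins_within_2[of V1 _ V2 "if x \<in> range B then x else B 0"])
  fix u v
  assume "{u, v} \<subseteq> verts (delete_edge (F_graph 0 t m2) {V2, x}) - {V1}"
    and dom: "dominating_set (delete_edge (F_graph 0 t m2) {V2, x}) {u, v}"
  with F_graph_0_dominating_pair[OF m] obtain i where "{u, v} = {V2, B i}"
    by (metis dominating_set_delete_edgeD verts_delete_edge)
  with dominating_setD[OF dom, of x] e
  show "{u, v} = {V2, if x \<in> range B then x else B 0}"
    by (cases x) (auto simp: verts_F_graph edges_F_graph_iff)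
qed (use m e in \<open>auto simp: verts_F_graph edges_F_graph_iff\<close>)

lemma F_graph_delete_edge:
  assumes m: "m2 \<ge> 2" "t \<ge> 1" "m1 = 0 \<or> m1 \<ge> 2" "m1 = 0 \<longrightarrow> t \<ge> 2"
    and e: "e \<in> edges (F_graph m1 t m2)"
  shows "\<not> dominator_wins_within (delete_edge (F_graph m1 t m2) e) 2 {} {}"
proof -
  have swap: "dominator_wins_within (delete_edge (F_graph m2 t m1) (swap_sides ` e)) 2 {} {} \<longleftrightarrow>
      dominator_wins_within (delete_edge (F_graph m1 t m2) e) 2 {} {}"
    if "e \<in> edges (F_graph m1 t m2)" for e
  proof -
    have "e \<subseteq> verts (F_graph m1 t m2)"
      using finite_simple_F_graph[of m1 t m2] that by (auto simp: finite_simple_graph_def)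
    from dominator_wins_within_iso[OF graph_iso_on_delete_edge[OF graph_iso_on_swap_sides this],
        of "{}" "{}"] show ?thesis by simp
  qed
  from e show ?thesis
  proof (cases rule: edges_F_graph_cases)
    case (V1 x)
    with F_graph_delete_edge_V1[OF m] show ?thesis by simp
  next
    case (H2 e')
    with F_graph_delete_edge_H2[OF m] show ?thesis by simp
  next
    case (V2 x)
    show ?thesis
    \<comment> \<open>The swap would turn \<open>m1 = 0\<close> into an empty \<open>H2\<close>
      part, so this case is treated directly.\<close>
    proof (cases "m1 = 0")
      case True
      with V2 m F_graph_0_delete_edge_V2 show ?thesis by blast
    next
      case False
      have "{V1, swap_sides x} \<in> edges (F_graph m2 t m1)"
        using V2(2) by (cases x) (auto simp: edges_F_graph_iff)
      \<comment> \<open>The variable \<open>m2\<close> comes first in the instantiated lemma, so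
        \<open>m1\<close> and \<open>m2\<close> exchange roles here.\<close>
      with swap[OF e] V2 F_graph_delete_edge_V1[of m1 t m2 "swap_sides x"] m False show ?thesis
        by simp
    qed
  next
    case (H1 e')
    then have "m1 \<noteq> 0" by (cases m1) (auto simp: edges_H_graph_0)
    moreover have "swap_sides ` e = H2 ` e'"
      unfolding H1 image_image by simp
    ultimately show ?thesis
      using swap[OF e] H1(2) F_graph_delete_edge_H2[of m1 t m2 e'] m by simp
  qed
qed

section \<open>Dominator's win in two moves, and criticality\<close>

lemma F_graph_wins_within_2:
  assumes m: "m2 \<ge> 2" "m1 = 0 \<or> m1 \<ge> 2" "m1 = 0 \<longrightarrow> t \<ge> 2"
  shows "dominator_wins_within (F_graph m1 t m2) 2 {} {}"
proof (rule wins_within_2I)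
  let ?G = "F_graph m1 t m2"
  show "verts ?G \<noteq> {}" using verts_F_graph(1) by blast
  have H: "Inl 0 \<in> verts (H_graph m)" "Inl 1 \<in> verts (H_graph m)" if "m \<ge> 2" for m
    using that by (auto simp: verts_H_graph)
  have H_adj: "q = p \<or> {p, q} \<in> edges (H_graph m)"
    if "m \<ge> 2" "q \<in> verts (H_graph m)" "p = Inl 0 \<or> p = Inl 1" for p q m
    using that by (auto simp: verts_H_graph edges_H_graph_iff)
  have domI: "dominating_set ?G {d, a}"
    if "{d, a} \<subseteq> verts ?G"
      "\<And>v. v \<in> verts ?G \<Longrightarrow> v = d \<or> v = a \<or> {d, v} \<in> edges ?G \<or> {a, v} \<in> edges ?G" for d a
    using that unfolding dominating_set_def by blast
  have V1V2: "dominating_set ?G {V1, V2}"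
  proof (rule domI)
    fix v
    assume "v \<in> verts ?G"
    then show "v = V1 \<or> v = V2 \<or> {V1, v} \<in> edges ?G \<or> {V2, v} \<in> edges ?G"
      by (cases v) (auto simp: verts_F_graph edges_F_graph_iff)
  qed (auto simp: verts_F_graph)
  have V1H2: "dominating_set ?G {V1, H2 p}" if p: "p = Inl 0 \<or> p = Inl 1" for p
  proof (rule domI)
    have "p \<in> verts (H_graph m2)" using p H[OF m(1)] by blast
    then show "{V1, H2 p} \<subseteq> verts ?G" by (auto simp: verts_F_graph)
    fix v
    assume "v \<in> verts ?G"
    with H_adj[OF m(1) _ p] \<open>p \<in> verts (H_graph m2)\<close>
    show "v = V1 \<or> v = H2 p \<or> {V1, v} \<in> edges ?G \<or> {H2 p, v} \<in> edges ?G"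
      by (cases v) (auto simp: verts_F_graph edges_F_graph_iff)
  qed
  have V2H1: "dominating_set ?G {V2, H1 p}" if p: "p = Inl 0 \<or> p = Inl 1" and m1: "m1 \<ge> 2" for p
  proof (rule domI)
    have "p \<in> verts (H_graph m1)" using p H[OF m1] by blast
    then show "{V2, H1 p} \<subseteq> verts ?G" by (auto simp: verts_F_graph)
    fix v
    assume "v \<in> verts ?G"
    with H_adj[OF m1 _ p] \<open>p \<in> verts (H_graph m1)\<close>
    show "v = V2 \<or> v = H1 p \<or> {V2, v} \<in> edges ?G \<or> {H1 p, v} \<in> edges ?G"
      by (cases v) (auto simp: verts_F_graph edges_F_graph_iff)
  qed
  have V2B: "dominating_set ?G {V2, B i}" if "m1 = 0" "i < t" for i
  proof (rule domI)
    fix v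
    assume "v \<in> verts ?G"
    with that show "v = V2 \<or> v = B i \<or> {V2, v} \<in> edges ?G \<or> {B i, v} \<in> edges ?G"
      by (cases v) (auto simp: verts_F_graph edges_F_graph_iff verts_H_graph)
  qed (use that in \<open>auto simp: verts_F_graph\<close>)
  fix s
  assume "s \<in> verts ?G"
  show "\<exists>d a b. {d, a, b} \<subseteq> verts ?G - {s} \<and> distinct [d, a, b] \<and>
      dominating_set ?G {d, a} \<and> dominating_set ?G {d, b}"
  \<comment> \<open>Dominator takes \<open>V1\<close> if he can. Otherwise he takes
    \<open>V2\<close>, whose partners are in the \<open>H1\<close> part, or in \<open>B\<close> if
    \<open>m1 = 0\<close>.\<close>
  proof (cases "s = V1")
    case True
    show ?thesis
    proof (cases "m1 = 0")
      case m1: True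
      with m(3) have "0 < t" "1 < t" by auto
      with True V2B[OF m1, of 0] V2B[OF m1, of 1] show ?thesis
        by (intro exI[of _ V2] exI[of _ "B 0"] exI[of _ "B 1"]) (auto simp: verts_F_graph)
    next
      case False
      with m(2) have "m1 \<ge> 2" by simp
      with True V2H1[of "Inl 0"] V2H1[of "Inl 1"] H[of m1] show ?thesis
        by (intro exI[of _ V2] exI[of _ "H1 (Inl 0)"] exI[of _ "H1 (Inl 1)"])
          (auto simp: verts_F_graph)
    qed
  next
    case False
    \<comment> \<open>Of three partners of \<open>V1\<close>, the vertex \<open>s\<close> removes at
      most one.\<close>
    consider "s \<notin> {V2, H2 (Inl 0)}" | "s \<notin> {V2, H2 (Inl 1)}" | "s \<notin> {H2 (Inl 0), H2 (Inl 1)}"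
      by (cases "s = V2"; cases "s = H2 (Inl 0)") auto
    then show ?thesis
    proof cases
      case 1
      with False V1V2 V1H2[of "Inl 0"] H[OF m(1)] show ?thesis
        by (intro exI[of _ V1] exI[of _ V2] exI[of _ "H2 (Inl 0)"]) (auto simp: verts_F_graph)
    next
      case 2
      with False V1V2 V1H2[of "Inl 1"] H[OF m(1)] show ?thesis
        by (intro exI[of _ V1] exI[of _ V2] exI[of _ "H2 (Inl 1)"]) (auto simp: verts_F_graph)
    next
      case 3
      with False V1H2[of "Inl 0"] V1H2[of "Inl 1"] H[OF m(1)] show ?thesis
        by (intro exI[of _ V1] exI[of _ "H2 (Inl 0)"] exI[of _ "H2 (Inl 1)"])
          (auto simp: verts_F_graph)
    qed
  qed
qed

lemma F_graph_critical:
  assumes m: "m2 \<ge> 2" "t \<ge> 1" "m1 = 0 \<or> m1 \<ge> 2" "m1 = 0 \<longrightarrow> t \<ge> 2"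
  shows "gamma_MB'_critical 2 (F_graph m1 t m2)"
proof -
  \<comment> \<open>If Staller opens with \<open>V2\<close>, one move cannot suffice: a single
    vertex is a degenerate pair, whereas dominating pairs avoiding \<open>V2\<close> have two
    distinct vertices.\<close>
  have "\<not> dominating_set (F_graph m1 t m2) {x}" if "x \<in> verts (F_graph m1 t m2) - {V2}" for x
    using F_graph_dominating_pair[OF m, of x x] that by auto
  then have "\<not> dominator_wins_within (F_graph m1 t m2) 1 {} {}"
    using not_wins_within_1[of V2] verts_F_graph(2) by blast
  then have "\<not> gamma_MB' (F_graph m1 t m2) \<le> enat 1"
    by (simp only: gamma_MB'_def game_value_le_iff not_False_eq_True)
  moreover have "gamma_MB' (F_graph m1 t m2) \<le> enat 2"
    using F_graph_wins_within_2[OF m(1,3,4)] by (simp only: gamma_MB'_def game_value_le_iff)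
  ultimately have "gamma_MB' (F_graph m1 t m2) = enat 2"
    by (cases "gamma_MB' (F_graph m1 t m2)") auto
  moreover have "gamma_MB' (delete_edge (F_graph m1 t m2) e) > enat 2"
    if "e \<in> edges (F_graph m1 t m2)" for e
    using F_graph_delete_edge[OF m that]
    by (simp only: gamma_MB'_def game_value_le_iff flip: not_le) simp
  ultimately show ?thesis
    by (simp add: gamma_MB'_critical_def)
qed

theorem proposition4p1:
  fixes G :: "'a graph"
  assumes "finite_simple_graph G"
    and "G \<in> family_F"
  shows "gamma_MB'_critical 2 G"
proof -
  obtain m1 t m2 where m: "m2 \<ge> 2" "t \<ge> 1" "m1 = 0 \<or> m1 \<ge> 2" "m1 = 0 \<longrightarrow> t \<ge> 2"
    and "graph_iso G (F_graph m1 t m2)"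
    using assms(2) by (auto simp: family_F_def)
  then obtain f where "graph_iso_on f G (F_graph m1 t m2)"
    by (auto simp: graph_iso_def graph_iso_on_def)
  then show ?thesis
    using gamma_MB'_critical_iso assms(1) F_graph_critical[OF m] by blast
qed

end
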